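(* Let $G(z)\in\mathbb{F}_2[z]^{k\times 2k}$ be a generator matrix, with rows $g_1(z),\dots,g_k(z)$, of a binary self-dual $(2k,k)$ convolutional code, let $a_1(z),\dots,a_k(z)\in\mathbb{F}_2[z]$, and let $$\tilde G(z)=\begin{pmatrix}a_1(z)&a_1(z)&g_1(z)\\ \vdots&\vdots&\vdots\\ a_k(z)&a_k(z)&g_k(z)\end{pmatrix}\in\mathbb{F}_2[z]^{k\times(2k+2)}.$$ Then a non-trivial self-dual completion of $\tilde G(z)$ exists if and only if $(1,\dots,1)\in\mathrm{rowspan}(\tilde G(z))$.
   Context: A binary $(n,k)$ convolutional code is an $\mathbb{F}_2[z]$-submodule $\mathcal{C}\subset\mathbb{F}_2[z]^n$ of rank $k$. A generator matrix of $\mathcal{C}$ is a matrix in $\mathbb{F}_2[z]^{k\times n}$ whose rows form a basis of $\mathcal{C}$; $\mathrm{rowspan}$ denotes the $\mathbb{F}_2[z]$-span of the rows. The dual is $\mathcal{C}^\perp=\{f(z)\in\mathbb{F}_2[z]^n : f(z)c(z)^\top=0\ \forall c(z)\in\mathcal{C}\}$, and $\mathcal{C}$ is self-dual if $\mathcal{C}=\mathcal{C}^\perp$. A self-dual completion of $\tilde G(z)$ is a matrix $G_1(z)=\begin{pmatrix}f(z)\\ \tilde G(z)\end{pmatrix}\in\mathbb{F}_2[z]^{(k+1)\times(2k+2)}$, with $f(z)\in\mathbb{F}_2[z]^{2k+2}$, that is a generator matrix of a self-dual $(2k+2,k+1)$ convolutional code. A self-dual completion $G_1(z)$ is trivial if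 it generates the same code as $\begin{pmatrix}(1,1,0,\dots,0)\\ \tilde G(z)\end{pmatrix}$, and non-trivial otherwise. *)

theory Defs
  imports "HOL-Library.Z2" "Jordan_Normal_Form.VS_Connect"
begin

text \<open>
  The field with two elements is \<^typ>\<open>bit\<close>, so polynomials over it are \<^typ>\<open>bit poly\<close>, and the
  free module of rank \<open>n\<close> over them is \<open>module_vec TYPE(bit poly) n\<close>.
\<close>

abbreviation poly_span :: "nat \<Rightarrow> bit poly vec set \<Rightarrow> bit poly vec set" where
  "poly_span n \<equiv> LinearCombinations.module.span class_ring (module_vec TYPE(bit poly) n)"

abbreviation poly_lin_indpt :: "nat \<Rightarrow> bit poly vec set \<Rightarrow> bool" where
  "poly_lin_indpt n \<equiv> LinearCombinations.module.lin_indpt class_ring (module_vec TYPE(bit poly) n)"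

definition basis_of :: "nat \<Rightarrow> bit poly vec set \<Rightarrow> bit poly vec set \<Rightarrow> bool" where
  "basis_of n C B \<longleftrightarrow> B \<subseteq> carrier_vec n \<and> poly_lin_indpt n B \<and> poly_span n B = C"

text \<open>
  The ring is a principal ideal domain, so every submodule is free and its rank is the size of
  any basis.
\<close>

definition conv_code :: "nat \<Rightarrow> nat \<Rightarrow> bit poly vec set \<Rightarrow> bool" where
  "conv_code n k C \<longleftrightarrow>
     LinearCombinations.submodule class_ring C (module_vec TYPE(bit poly) n) \<and>
     (\<exists>B. finite B \<and> card B = k \<and> basis_of n C B)"

definition rowspan :: "bit poly mat \<Rightarrow> bit poly vec set" where
  "rowspan G = poly_span (dim_col G) (set (rows G))"

text \<open>
  Distinctness is needed because linear independence is a property of the \<^emph>\<open>set\<close> of rows.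
\<close>

definition generator_matrix :: "nat \<Rightarrow> nat \<Rightarrow> bit poly vec set \<Rightarrow> bit poly mat \<Rightarrow> bool" where
  "generator_matrix n k C G \<longleftrightarrow>
     G \<in> carrier_mat k n \<and> distinct (rows G) \<and> basis_of n C (set (rows G))"

definition dual_code :: "nat \<Rightarrow> bit poly vec set \<Rightarrow> bit poly vec set" where
  "dual_code n C = {f \<in> carrier_vec n. \<forall>c\<in>C. f \<bullet> c = 0}"

definition self_dual :: "nat \<Rightarrow> bit poly vec set \<Rightarrow> bool" where
  "self_dual n C \<longleftrightarrow> C = dual_code n C"

definition extended_matrix :: "nat \<Rightarrow> (nat \<Rightarrow> bit poly) \<Rightarrow> bit poly mat \<Rightarrow> bit poly mat" where
  "extended_matrix k a G = mat k (2 * k + 2) (\<lambda>(i, j). if j < 2 then a i else G $$ (i, j - 2))"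

definition self_dual_completion :: "nat \<Rightarrow> bit poly mat \<Rightarrow> bit poly mat \<Rightarrow> bool" where
  "self_dual_completion k Gt G1 \<longleftrightarrow>
     (\<exists>f \<in> carrier_vec (2 * k + 2). G1 = mat_of_rows (2 * k + 2) (f # rows Gt)) \<and>
     (\<exists>C. conv_code (2 * k + 2) (k + 1) C \<and> self_dual (2 * k + 2) C \<and>
          generator_matrix (2 * k + 2) (k + 1) C G1)"

definition trivial_completion :: "nat \<Rightarrow> bit poly mat \<Rightarrow> bit poly mat \<Rightarrow> bool" where
  "trivial_completion k Gt G1 \<longleftrightarrow>
     rowspan G1 =
     rowspan (mat_of_rows (2 * k + 2) (vec (2 * k + 2) (\<lambda>j. if j < 2 then 1 else 0) # rows Gt))"

end

theory Submission
  imports Defs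
begin

text \<open>
  Write \<open>E\<close> for the extended matrix, \<open>D\<close> for its row span over \<open>R = F\<^sub>2[z]\<close>, and \<open>e = (1,1,0,\<dots>,0)\<close>. In
  characteristic 2, \<open>v \<bullet> v = (v \<bullet> 1)\<^sup>2\<close> for the all-one vector \<open>1\<close>, so \<open>1\<close> lies in every self-dual
  code. Self-duality of \<open>G\<close> shows that a vector of \<open>D\<^sup>\<bottom>\<close> orthogonal to \<open>e\<close> lies in \<open>D + R e\<close>.

  Given a completion by \<open>f\<close>, write \<open>1 = x f + d\<close> with \<open>d \<in> D\<close>. If \<open>x \<noteq> 0\<close> then \<open>f \<in> D + R e\<close>, and the
  completion is trivial; otherwise \<open>1 \<in> D\<close>.

  Conversely let \<open>1 \<in> D\<close>, and choose \<open>t \<in> D\<^sup>\<bottom>\<close> with \<open>e \<bullet> t \<noteq> 0\<close> and \<open>e \<bullet> t\<close> of minimal degree. Division with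
  remainder gives \<open>D\<^sup>\<bottom> = D + R e + R t\<close>, and \<open>t \<bullet> t = (t \<bullet> 1)\<^sup>2 = 0\<close>. So \<open>D + R t\<close> is self-dual, and it
  does not contain \<open>e\<close>.
\<close>

section \<open>Independent rows and row extension\<close>

text \<open>Independence of the rows as an indexed family, so a repeated row counts as a dependence.
  One condition captures both distinctness and independence of the row set.\<close>

definition row_free :: "'a :: comm_ring_1 mat \<Rightarrow> bool" where
  "row_free M \<longleftrightarrow> (\<forall>c \<in> carrier_vec (dim_row M).
     transpose_mat M *\<^sub>v c = 0\<^sub>v (dim_col M) \<longrightarrow> c = 0\<^sub>v (dim_row M))"

text \<open>Putting \<open>f\<close> in front matches the shape of a completion and the constructor
  \<open>vCons\<close>: coefficient vectors of the larger matrix split as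
  \<open>vCons x c\<close>.\<close>

definition add_row :: "'a vec \<Rightarrow> 'a mat \<Rightarrow> 'a mat" where
  "add_row f M = mat_of_rows (dim_col M) (f # rows M)"

lemma add_row_carrier [simp]: "M \<in> carrier_mat k n \<Longrightarrow> add_row f M \<in> carrier_mat (Suc k) n"
  unfolding add_row_def carrier_mat_def by simp

lemma add_row_dim [simp]:
  "dim_row (add_row f M) = Suc (dim_row M)" "dim_col (add_row f M) = dim_col M"
  unfolding add_row_def by simp_all

lemma row_add_row:
  assumes "M \<in> carrier_mat k n" "f \<in> carrier_vec n"
  shows "row (add_row f M) 0 = f" "i < k \<Longrightarrow> row (add_row f M) (Suc i) = row M i"
  using assms unfolding add_row_def by (simp_all)

lemma add_row_mult_vec:
  assumes "M \<in> carrier_mat k n" "f \<in> carrier_vec n"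
  shows "add_row f M *\<^sub>v w = vCons (f \<bullet> w) (M *\<^sub>v w)"
proof (rule eq_vecI)
  fix i assume "i < dim_vec (vCons (f \<bullet> w) (M *\<^sub>v w))"
  then show "(add_row f M *\<^sub>v w) $ i = vCons (f \<bullet> w) (M *\<^sub>v w) $ i"
    using assms by (cases i) (auto simp: row_add_row)
qed (use assms in auto)

lemma transpose_add_row_mult_vec:
  fixes M :: "'a :: comm_ring_1 mat"
  assumes "M \<in> carrier_mat k n" "f \<in> carrier_vec n" "c \<in> carrier_vec k"
  shows "transpose_mat (add_row f M) *\<^sub>v vCons x c = x \<cdot>\<^sub>v f + transpose_mat M *\<^sub>v c"
proof (rule eq_vecI)
  have D: "add_row f M \<in> carrier_mat (Suc k) n" using assms by simp
  show "dim_vec (transpose_mat (add_row f M) *\<^sub>v vCons x c) =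
    dim_vec (x \<cdot>\<^sub>v f + transpose_mat M *\<^sub>v c)" using assms D by simp
  fix i assume "i < dim_vec (x \<cdot>\<^sub>v f + transpose_mat M *\<^sub>v c)"
  then have i: "i < n" using assms by simp
  have "col (add_row f M) i = vCons (f $ i) (col M i)"
  proof (rule eq_vecI)
    fix j assume "j < dim_vec (vCons (f $ i) (col M i))"
    then show "col (add_row f M) i $ j = vCons (f $ i) (col M i) $ j"
      using assms i by (cases j) (auto simp: add_row_def mat_of_rows_def)
  qed (use assms D in simp)
  then show "(transpose_mat (add_row f M) *\<^sub>v vCons x c) $ i =
    (x \<cdot>\<^sub>v f + transpose_mat M *\<^sub>v c) $ i"
    using assms D i by (simp add: mult.commute)
qed

lemma transpose_mult_vec_scalar_prod:
  fixes M :: "'a :: comm_ring_1 mat"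
  assumes "M \<in> carrier_mat k n" "c \<in> carrier_vec k" "w \<in> carrier_vec n"
  shows "w \<bullet> (transpose_mat M *\<^sub>v c) = c \<bullet> (M *\<^sub>v w)"
proof -
  have "(transpose_mat M *\<^sub>v c) \<bullet> w = c \<bullet> (M *\<^sub>v w)"
    by (rule transpose_vec_mult_scalar) (use assms in auto)
  moreover have "w \<bullet> (transpose_mat M *\<^sub>v c) = (transpose_mat M *\<^sub>v c) \<bullet> w"
    by (rule comm_scalar_prod) (use assms in auto)
  ultimately show ?thesis by simp
qed

text \<open>Provides the induction on the number of rows.\<close>

lemma ex_add_row:
  assumes "M \<in> carrier_mat (Suc k) n"
  shows "\<exists>f N. f \<in> carrier_vec n \<and> N \<in> carrier_mat k n \<and> M = add_row f N"
proof (intro exI conjI)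
  let ?N = "mat k n (\<lambda>(i, j). M $$ (Suc i, j))"
  show "row M 0 \<in> carrier_vec n" "?N \<in> carrier_mat k n" using assms by auto
  show "M = add_row (row M 0) ?N"
  proof (rule eq_rowI)
    fix i assume "i < dim_row (add_row (row M 0) ?N)"
    then show "row M i = row (add_row (row M 0) ?N) i"
      using assms row_add_row[of ?N k n "row M 0"] by (cases i) (auto simp: add_row_def)
  qed (use assms in \<open>auto simp: add_row_def\<close>)
qed

lemma row_freeD:
  assumes "row_free M" "M \<in> carrier_mat k n" "c \<in> carrier_vec k"
    "transpose_mat M *\<^sub>v c = 0\<^sub>v n"
  shows "c = 0\<^sub>v k"
  using assms unfolding row_free_def by auto

lemma row_free_add_rowD:
  assumes "row_free (add_row f M)" "M \<in> carrier_mat k n" "f \<in> carrier_vec n"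
  shows "row_free M"
  unfolding row_free_def
proof (intro ballI impI)
  fix c assume c: "c \<in> carrier_vec (dim_row M)" "transpose_mat M *\<^sub>v c = 0\<^sub>v (dim_col M)"
  have "transpose_mat (add_row f M) *\<^sub>v vCons 0 c = 0\<^sub>v n"
    using c assms by (subst transpose_add_row_mult_vec) auto
  from row_freeD[OF assms(1) _ _ this, of "Suc k"] c assms
  show "c = 0\<^sub>v (dim_row M)" by (simp add: zero_vec_Suc)
qed

section \<open>Linear systems over an integral domain\<close>

lemma mult_mat_vec_smult:
  fixes M :: "'a :: comm_ring_1 mat"
  assumes "M \<in> carrier_mat k n" "v \<in> carrier_vec n"
  shows "M *\<^sub>v (b \<cdot>\<^sub>v v) = b \<cdot>\<^sub>v (M *\<^sub>v v)"
  using assms by (intro eq_vecI) auto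

lemma smult_one_mat_mult_vec:
  fixes x :: "'a :: comm_ring_1 vec"
  assumes "x \<in> carrier_vec k"
  shows "(b \<cdot>\<^sub>m 1\<^sub>m k) *\<^sub>v x = b \<cdot>\<^sub>v x"
  using assms by (intro eq_vecI) auto

text \<open>
  Both claims are proved together by adding one row at a time. If \<open>N W = b I\<close> and \<open>v\<close> is any vector,
  then \<open>b v - W N v\<close> lies in the kernel of \<open>N\<close>, and its product with the new row \<open>f\<close> is
  \<open>v \<bullet> (b f - N\<^sup>T W\<^sup>T f)\<close>, where the second factor is non-zero by independence. Scaling by \<open>b\<close>
  replaces a passage to the field of fractions.
\<close>

lemma
  fixes M :: "'a :: idom mat"
  assumes "M \<in> carrier_mat k n" "row_free M"
  shows row_free_solvable_up_to_scaling:
      "\<exists>b. b \<noteq> 0 \<and> (\<forall>c \<in> carrier_vec k. \<exists>w \<in> carrier_vec n. M *\<^sub>v w = b \<cdot>\<^sub>v c)"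
    and row_free_kernel_separates: "\<And>f. f \<in> carrier_vec n \<Longrightarrow> row_free (add_row f M) \<Longrightarrow>
      \<exists>w \<in> carrier_vec n. M *\<^sub>v w = 0\<^sub>v k \<and> f \<bullet> w \<noteq> 0"
proof -
  have step: "\<exists>w \<in> carrier_vec n. N *\<^sub>v w = 0\<^sub>v k \<and> f \<bullet> w \<noteq> 0"
    if N: "N \<in> carrier_mat k n" and f: "f \<in> carrier_vec n" and free: "row_free (add_row f N)"
      and b: "b \<noteq> 0" and ex: "\<forall>c \<in> carrier_vec k. \<exists>w \<in> carrier_vec n. N *\<^sub>v w = b \<cdot>\<^sub>v c"
    for N :: "'a mat" and k f b
  proof -
    have "\<forall>c \<in> carrier_vec k. \<exists>w. w \<in> carrier_vec n \<and> N *\<^sub>v w = b \<cdot>\<^sub>v c"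
      using ex by blast
    from bchoice[OF this] obtain w where
      "\<forall>c \<in> carrier_vec k. w c \<in> carrier_vec n \<and> N *\<^sub>v w c = b \<cdot>\<^sub>v c" ..
    then have w: "w c \<in> carrier_vec n" "N *\<^sub>v w c = b \<cdot>\<^sub>v c" if "c \<in> carrier_vec k" for c
      using that by blast+
    define W where "W = mat_of_cols n (map (\<lambda>i. w (unit_vec k i)) [0..<k])"
    have W: "W \<in> carrier_mat n k"
      unfolding W_def by (rule carrier_matI) simp_all
    have colW: "col W i = w (unit_vec k i)" if "i < k" for i
      unfolding W_def using that w(1)[of "unit_vec k i"] by simp
    have NW: "N * W = b \<cdot>\<^sub>m 1\<^sub>m k"
    proof (rule mat_col_eqI)
      fix i assume "i < dim_col (b \<cdot>\<^sub>m (1\<^sub>m k :: 'a mat))"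
      then have i: "i < k" by simp
      have "col (N * W) i = b \<cdot>\<^sub>v unit_vec k i"
        using col_mult2[OF N W i] colW[OF i] w(2)[of "unit_vec k i"] by simp
      then show "col (N * W) i = col (b \<cdot>\<^sub>m 1\<^sub>m k) i" using i by simp
    qed (use N W in auto)
    define u where "u = b \<cdot>\<^sub>v f + transpose_mat N *\<^sub>v (- (transpose_mat W *\<^sub>v f))"
    have u: "u \<in> carrier_vec n" using N f W by (simp add: u_def)
    have "u \<noteq> 0\<^sub>v n"
    proof
      assume "u = 0\<^sub>v n"
      then have "transpose_mat (add_row f N) *\<^sub>v vCons b (- (transpose_mat W *\<^sub>v f)) = 0\<^sub>v n"
        using N f W by (subst transpose_add_row_mult_vec) (auto simp: u_def)
      from row_freeD[OF free _ _ this, of "Suc k"] N W f b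
      show False by (simp add: zero_vec_Suc)
    qed
    then obtain i where i: "i < n" "u $ i \<noteq> 0" using u by (auto simp: vec_eq_iff)
    \<comment> \<open>A coordinate at which \<open>u\<close> does not vanish gives a unit vector
      whose product with \<open>u\<close> is non-zero.\<close>
    define v where "v = (unit_vec n i :: 'a vec)"
    have v: "v \<in> carrier_vec n" by (simp add: v_def)
    define x where "x = b \<cdot>\<^sub>v v - W *\<^sub>v (N *\<^sub>v v)"
    have x: "x \<in> carrier_vec n" using v W N by (auto simp: x_def)
    have Nv: "N *\<^sub>v v \<in> carrier_vec k" using N v by auto
    have WNv: "W *\<^sub>v (N *\<^sub>v v) \<in> carrier_vec n" using W Nv by auto
    have "N *\<^sub>v (W *\<^sub>v (N *\<^sub>v v)) = b \<cdot>\<^sub>v (N *\<^sub>v v)"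
      using assoc_mult_mat_vec[OF N W Nv] Nv
      by (simp add: NW smult_one_mat_mult_vec)
    then have "N *\<^sub>v x = 0\<^sub>v k"
      unfolding x_def using mult_minus_distrib_mat_vec[OF N _ WNv, of "b \<cdot>\<^sub>v v"] v N
      by (simp add: mult_mat_vec_smult[OF N v])
    moreover have "f \<bullet> x = u $ i"
    proof -
      have "f \<bullet> (W *\<^sub>v (N *\<^sub>v v)) = (transpose_mat W *\<^sub>v f) \<bullet> (N *\<^sub>v v)"
        using transpose_vec_mult_scalar[OF W Nv f] by simp
      also have "\<dots> = v \<bullet> (transpose_mat N *\<^sub>v (transpose_mat W *\<^sub>v f))"
        by (rule transpose_mult_vec_scalar_prod[symmetric, OF N _ v]) (use W f in auto)
      finally have 1: "f \<bullet> (W *\<^sub>v (N *\<^sub>v v)) = (transpose_mat N *\<^sub>v (transpose_mat W *\<^sub>v f)) $ i"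
        unfolding v_def using i N W f by (simp only:) (rule scalar_prod_left_unit, auto)
      have "f \<bullet> x = b * f $ i - (transpose_mat N *\<^sub>v (transpose_mat W *\<^sub>v f)) $ i"
        unfolding x_def using scalar_prod_minus_distrib[OF f _ WNv, of "b \<cdot>\<^sub>v v"] v f i 1
        by (simp add: v_def)
      also have "\<dots> = u $ i" unfolding u_def using i f N W by simp
      finally show ?thesis .
    qed
    ultimately show ?thesis using x i by auto
  qed
  show ex: "\<exists>b. b \<noteq> 0 \<and> (\<forall>c \<in> carrier_vec k. \<exists>w \<in> carrier_vec n. M *\<^sub>v w = b \<cdot>\<^sub>v c)"
    using assms
  proof (induction k arbitrary: M)
    case 0
    then show ?case by (intro exI[of _ 1]) (auto intro!: bexI[of _ "0\<^sub>v n"])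
  next
    case (Suc k)
    from ex_add_row[OF Suc.prems(1)] obtain f N where
      f: "f \<in> carrier_vec n" and N: "N \<in> carrier_mat k n" and M: "M = add_row f N" by blast
    have free: "row_free N" using row_free_add_rowD Suc.prems f N M by blast
    from Suc.IH[OF N free] obtain b where b: "b \<noteq> 0"
      and ex: "\<forall>c \<in> carrier_vec k. \<exists>w \<in> carrier_vec n. N *\<^sub>v w = b \<cdot>\<^sub>v c" by blast
    from step[OF N f _ b ex] Suc.prems M obtain z where
      z: "z \<in> carrier_vec n" "N *\<^sub>v z = 0\<^sub>v k" "f \<bullet> z \<noteq> 0" by blast
    show ?case
    proof (intro exI[of _ "(f \<bullet> z) * b"] conjI ballI)
      show "(f \<bullet> z) * b \<noteq> 0" using b z by simp
      fix c :: "'a vec" assume c: "c \<in> carrier_vec (Suc k)"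
      then obtain y d where cd: "c = vCons y d" "d \<in> carrier_vec k"
        by (cases c) auto
      from ex cd obtain w where w: "w \<in> carrier_vec n" "N *\<^sub>v w = b \<cdot>\<^sub>v d" by blast
      \<comment> \<open>The first summand has the required product with each row of
        \<open>N\<close>. Adding a multiple of \<open>z\<close>, which \<open>N\<close> annihilates,
        corrects the product with \<open>f\<close> alone; the factor \<open>f \<bullet> z\<close>
        makes this possible without division.\<close>
      let ?w = "(f \<bullet> z) \<cdot>\<^sub>v w + (b * y - f \<bullet> w) \<cdot>\<^sub>v z"
      have "(b * y - f \<bullet> w) \<cdot>\<^sub>v 0\<^sub>v k = 0\<^sub>v k" by (intro eq_vecI) auto
      then have "N *\<^sub>v ?w = (f \<bullet> z * b) \<cdot>\<^sub>v d"
        using mult_add_distrib_mat_vec[OF N, of "(f \<bullet> z) \<cdot>\<^sub>v w" "(b * y - f \<bullet> w) \<cdot>\<^sub>v z"] w z cd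
        by (simp add: mult_mat_vec_smult[OF N] smult_smult_assoc)
      moreover have "f \<bullet> ?w = (f \<bullet> z * b) * y"
        using scalar_prod_add_distrib[OF f, of "(f \<bullet> z) \<cdot>\<^sub>v w" "(b * y - f \<bullet> w) \<cdot>\<^sub>v z"] w z f
        by (simp add: algebra_simps)
      ultimately have "M *\<^sub>v ?w = (f \<bullet> z * b) \<cdot>\<^sub>v c"
        unfolding M add_row_mult_vec[OF N f] cd
        by (auto intro!: eq_vecI simp: vec_index_vCons)
      then show "\<exists>w \<in> carrier_vec n. M *\<^sub>v w = (f \<bullet> z * b) \<cdot>\<^sub>v c"
        using w z by (intro bexI[of _ ?w]) auto
    qed
  qed
  fix f assume "f \<in> carrier_vec n" "row_free (add_row f M)"
  then show "\<exists>w \<in> carrier_vec n. M *\<^sub>v w = 0\<^sub>v k \<and> f \<bullet> w \<noteq> 0"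
    using step[OF assms(1)] ex by blast
qed

section \<open>Spans and linear independence through coefficient vectors\<close>

context idom_vec
begin

lemma lincomb_list_rows:
  assumes "M \<in> carrier_mat k n"
  shows "lincomb_list c (rows M) = transpose_mat M *\<^sub>v vec k c"
proof -
  have "mat_of_cols n (rows M) = transpose_mat M"
    using assms by (metis carrier_matD(2) mat_of_rows_rows transpose_mat_of_rows)
  moreover have "\<forall>w \<in> set (rows M). dim_vec w = n" using assms by (auto simp: rows_def)
  ultimately show ?thesis using assms by (simp add: lincomb_list_as_mat_mult)
qed

lemma span_rows:
  assumes "M \<in> carrier_mat k n"
  shows "span (set (rows M)) = {transpose_mat M *\<^sub>v c | c. c \<in> carrier_vec k}"
proof -
  have "span (set (rows M)) = span_list (rows M)"
    using assms by (intro span_list_as_span[symmetric]) (auto simp: rows_def)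
  also have "\<dots> = {transpose_mat M *\<^sub>v vec k c | c. True}"
    unfolding span_list_def lincomb_list_rows[OF assms] by auto
  also have "\<dots> = {transpose_mat M *\<^sub>v c | c. c \<in> carrier_vec k}"
  proof (rule equalityI; rule subsetI)
    fix v assume "v \<in> {transpose_mat M *\<^sub>v c | c. c \<in> carrier_vec k}"
    then obtain c where "c \<in> carrier_vec k" "v = transpose_mat M *\<^sub>v c" by blast
    moreover from this have "vec k (\<lambda>i. c $ i) = c" by (intro eq_vecI) auto
    ultimately show "v \<in> {transpose_mat M *\<^sub>v vec k c | c. True}" by (metis (mono_tags, lifting) mem_Collect_eq)
  qed auto
  finally show ?thesis .
qed

lemma row_free_iff_lin_indpt:
  assumes "M \<in> carrier_mat k n"
  shows "row_free M \<longleftrightarrow> distinct (rows M) \<and> lin_indpt (set (rows M))"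
proof -
  have carr: "set (rows M) \<subseteq> carrier_vec n" using assms by (auto simp: rows_def)
  have len: "length (rows M) = k" using assms by simp
  show ?thesis
  proof safe
    assume free: "row_free M"
    show dist: "distinct (rows M)"
      unfolding distinct_conv_nth len
    proof (intro allI impI notI)
      fix i j assume ij: "i < k" "j < k" "i \<noteq> j" "rows M ! i = rows M ! j"
      have "M $$ (i, l) = M $$ (j, l)" if "l < n" for l
        using ij assms that by (metis carrier_matD index_row(1) nth_rows)
      \<comment> \<open>Two equal rows satisfy the relation with coefficients 1 and -1.\<close>
      then have "transpose_mat M *\<^sub>v (unit_vec k i - unit_vec k j) = 0\<^sub>v n"
        using assms ij by (intro eq_vecI) (auto simp: scalar_prod_minus_distrib[of _ k])
      from row_freeD[OF free assms _ this] have "(unit_vec k i - unit_vec k j) $ i = (0::'a)"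
        using ij by simp
      then show False using ij by simp
    qed
    assume "lin_dep (set (rows M))"
    then obtain A a v where A: "finite A" "A \<subseteq> set (rows M)" "lincomb a A = 0\<^sub>v n" "v \<in> A" "a v \<noteq> 0"
      unfolding lin_dep_def by auto
    \<comment> \<open>Extending the dependence by zero from \<open>A\<close> to all rows turns it
      into a coefficient vector of length \<open>k\<close>.\<close>
    define a' where "a' = (\<lambda>x. if x \<in> A then a x else 0)"
    have "lincomb a' (set (rows M)) = lincomb a' (set (rows M) - A) + lincomb a' A"
      by (rule lincomb_vec_diff_add[OF carr A(2)]) auto
    also have "lincomb a' (set (rows M) - A) = 0\<^sub>v n"
      by (rule lincomb_zero) (use carr in \<open>auto simp: a'_def\<close>)
    also have "lincomb a' A = lincomb a A"
      using A carr unfolding lincomb_def a'_def by (intro finsum_cong2) auto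
    finally have "lincomb a' (set (rows M)) = 0\<^sub>v n" using A by simp
    then have "transpose_mat M *\<^sub>v vec k (\<lambda>i. a' (rows M ! i)) = 0\<^sub>v n"
      unfolding lincomb_as_lincomb_list_distinct[OF carr dist] lincomb_list_rows[OF assms] .
    from row_freeD[OF free assms _ this] have 0: "a' (rows M ! i) = 0" if "i < k" for i
      using that by (metis index_vec index_zero_vec(1) vec_carrier)
    obtain i where "i < k" "rows M ! i = v" using A len by (metis in_mono in_set_conv_nth)
    with 0[of i] A show False by (simp add: a'_def)
  next
    assume dist: "distinct (rows M)" and indpt: "lin_indpt (set (rows M))"
    show "row_free M" unfolding row_free_def
    proof (intro ballI impI)
      fix c assume c: "c \<in> carrier_vec (dim_row M)" "transpose_mat M *\<^sub>v c = 0\<^sub>v (dim_col M)"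
      \<comment> \<open>Since the rows are distinct, each row determines its index, so coefficients
        indexed by position become a function on the set of rows.\<close>
      define a where "a = (\<lambda>x. c $ (THE i. i < k \<and> rows M ! i = x))"
      have a: "a (rows M ! i) = c $ i" if "i < k" for i
      proof -
        have "(THE j. j < k \<and> rows M ! j = rows M ! i) = i"
          using that dist unfolding distinct_conv_nth len by (intro the_equality) blast+
        then show ?thesis by (simp add: a_def)
      qed
      have "vec k (\<lambda>i. a (rows M ! i)) = c" using a c assms by (intro eq_vecI) auto
      then have "lincomb a (set (rows M)) = 0\<^sub>v n"
        unfolding lincomb_as_lincomb_list_distinct[OF carr dist] lincomb_list_rows[OF assms]
        using c assms by simp
      then have "a v = 0" if "v \<in> set (rows M)" for v
        using that indpt unfolding lin_dep_def by auto
      then show "c = 0\<^sub>v (dim_row M)"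
        using a c assms len by (intro eq_vecI) (auto simp flip: a simp: rows_def)
    qed
  qed
qed

end

section \<open>Codes, generator matrices and duals in matrix form\<close>

lemma rowspan_eq:
  assumes "M \<in> carrier_mat k n"
  shows "rowspan M = {transpose_mat M *\<^sub>v c | c. c \<in> carrier_vec k}"
proof -
  interpret idom_vec where f_ty = "TYPE(bit poly)" and n = n .
  show ?thesis using span_rows[OF assms] assms by (simp add: rowspan_def)
qed

lemma rowspan_carrier: "M \<in> carrier_mat k n \<Longrightarrow> rowspan M \<subseteq> carrier_vec n"
  by (auto simp: rowspan_eq)

lemma generator_matrix_iff:
  assumes "M \<in> carrier_mat k n"
  shows "generator_matrix n k C M \<longleftrightarrow> row_free M \<and> C = rowspan M"
proof -
  interpret idom_vec where f_ty = "TYPE(bit poly)" and n = n .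
  have "set (rows M) \<subseteq> carrier_vec n" using assms by (auto simp: rows_def)
  then show ?thesis
    using row_free_iff_lin_indpt[OF assms] assms
    by (auto simp: generator_matrix_def basis_of_def rowspan_def)
qed

lemma conv_code_rowspan:
  assumes "M \<in> carrier_mat k n" "row_free M"
  shows "conv_code n k (rowspan M)"
proof -
  interpret idom_vec where f_ty = "TYPE(bit poly)" and n = n .
  have carr: "set (rows M) \<subseteq> carrier_vec n" using assms by (auto simp: rows_def)
  have "submodule class_ring (rowspan M) V"
    using span_is_submodule[OF carr] assms by (simp add: rowspan_def)
  moreover have "card (set (rows M)) = k"
    using row_free_iff_lin_indpt[OF assms(1)] assms by (simp add: distinct_card)
  moreover have "basis_of n (rowspan M) (set (rows M))"
    using generator_matrix_iff[OF assms(1), of "rowspan M"] assms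
    by (simp add: generator_matrix_def)
  ultimately show ?thesis unfolding conv_code_def by blast
qed

text \<open>By \<open>w \<bullet> (transpose_mat M *\<^sub>v c) = c \<bullet> (M *\<^sub>v
  w)\<close>, orthogonality to the rows extends to their span; unit vectors \<open>c\<close> recover
  the individual rows.\<close>

lemma dual_code_rowspan:
  assumes "M \<in> carrier_mat k n"
  shows "dual_code n (rowspan M) = {w \<in> carrier_vec n. M *\<^sub>v w = 0\<^sub>v k}"
proof -
  have "(\<forall>c \<in> rowspan M. w \<bullet> c = 0) \<longleftrightarrow> M *\<^sub>v w = 0\<^sub>v k" if w: "w \<in> carrier_vec n" for w
  proof
    assume *: "\<forall>c \<in> rowspan M. w \<bullet> c = 0"
    show "M *\<^sub>v w = 0\<^sub>v k"
    proof (rule eq_vecI)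
      fix i assume "i < dim_vec (0\<^sub>v k :: bit poly vec)"
      then have i: "i < k" by simp
      have "w \<bullet> (transpose_mat M *\<^sub>v unit_vec k i) = (M *\<^sub>v w) $ i"
        using transpose_mult_vec_scalar_prod[OF assms _ w, of "unit_vec k i"] i assms w
          scalar_prod_left_unit[OF mult_mat_vec_carrier[OF assms w] i] by simp
      moreover have "transpose_mat M *\<^sub>v unit_vec k i \<in> rowspan M"
        unfolding rowspan_eq[OF assms] by (auto intro: unit_vec_carrier)
      ultimately show "(M *\<^sub>v w) $ i = 0\<^sub>v k $ i" using * i by simp
    qed (use assms in simp)
  next
    assume "M *\<^sub>v w = 0\<^sub>v k"
    then show "\<forall>c \<in> rowspan M. w \<bullet> c = 0"
      using transpose_mult_vec_scalar_prod[OF assms _ w] by (auto simp: rowspan_eq[OF assms])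
  qed
  then show ?thesis unfolding dual_code_def by blast
qed

section \<open>Characteristic 2 and the all-one vector\<close>

lemma bit_poly_add_self [simp]: "p + p = (0 :: bit poly)"
proof (rule poly_eqI)
  have "b + b = 0" for b :: bit by (cases b) simp_all
  then show "coeff (p + p) n = coeff 0 n" for n by (simp only: coeff_add coeff_0)
qed

lemma bit_poly_eq_iff_add_eq_0: "p = q \<longleftrightarrow> p + q = (0 :: bit poly)"
  by (metis add_right_cancel bit_poly_add_self)

text \<open>Squaring is additive in characteristic 2, because every cross term occurs twice.\<close>

lemma scalar_prod_self:
  fixes v :: "bit poly vec"
  assumes "v \<in> carrier_vec n"
  shows "v \<bullet> v = (v \<bullet> vec n (\<lambda>_. 1)) ^ 2"
proof -
  have "(\<Sum>i\<in>A. f i * f i) = (\<Sum>i\<in>A. f i) ^ 2" if "finite A" for f :: "nat \<Rightarrow> bit poly" and A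
    using that
  proof induction
    case (insert i A)
    have "(f i + (\<Sum>i\<in>A. f i))\<^sup>2 = (f i)\<^sup>2 + (\<Sum>i\<in>A. f i)\<^sup>2
        + (f i * (\<Sum>i\<in>A. f i) + f i * (\<Sum>i\<in>A. f i))"
      by (simp only: power2_eq_square algebra_simps)
    then show ?case using insert by (simp add: power2_eq_square)
  qed simp
  then show ?thesis using assms by (simp add: scalar_prod_def)
qed

lemma scalar_prod_ones_eq_0:
  fixes v :: "bit poly vec"
  assumes "v \<in> carrier_vec n" "v \<bullet> v = 0"
  shows "v \<bullet> vec n (\<lambda>_. 1) = 0"
  using scalar_prod_self[OF assms(1)] assms(2) by simp

text \<open>A codeword \<open>c\<close> of a self-orthogonal code has
  \<open>c \<bullet> c = 0\<close>, and this is the square of its product with the all-one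
  vector.\<close>

lemma rowspan_subset_dual_imp_ones:
  assumes "M \<in> carrier_mat k n" "rowspan M \<subseteq> dual_code n (rowspan M)"
  shows "vec n (\<lambda>_. 1) \<in> dual_code n (rowspan M)"
proof -
  let ?o = "vec n (\<lambda>_. 1) :: bit poly vec"
  have "?o \<bullet> c = 0" if c: "c \<in> rowspan M" for c
  proof -
    have "c \<in> carrier_vec n" "c \<bullet> c = 0"
      using assms(2) c by (auto simp: dual_code_def)
    then have "c \<bullet> ?o = 0" by (rule scalar_prod_ones_eq_0)
    then show ?thesis using comm_scalar_prod[of c n ?o] \<open>c \<in> carrier_vec n\<close> by simp
  qed
  then show ?thesis by (simp add: dual_code_def)
qed

lemma in_rowspan_add_row:
  assumes "M \<in> carrier_mat k n" "f \<in> carrier_vec n"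
  shows "v \<in> rowspan (add_row f M) \<longleftrightarrow>
    (\<exists>x. \<exists>c \<in> carrier_vec k. v = x \<cdot>\<^sub>v f + transpose_mat M *\<^sub>v c)"
proof -
  have "v \<in> rowspan (add_row f M) \<longleftrightarrow>
    (\<exists>d \<in> carrier_vec (Suc k). v = transpose_mat (add_row f M) *\<^sub>v d)"
    using rowspan_eq[OF add_row_carrier[OF assms(1)]] by auto
  also have "\<dots> \<longleftrightarrow> (\<exists>x. \<exists>c \<in> carrier_vec k. v = transpose_mat (add_row f M) *\<^sub>v vCons x c)"
  proof
    assume "\<exists>d \<in> carrier_vec (Suc k). v = transpose_mat (add_row f M) *\<^sub>v d"
    then obtain d where d: "d \<in> carrier_vec (Suc k)" "v = transpose_mat (add_row f M) *\<^sub>v d" by blast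
    then obtain x c where "d = vCons x c" by (cases d) auto
    with d show "\<exists>x. \<exists>c \<in> carrier_vec k. v = transpose_mat (add_row f M) *\<^sub>v vCons x c" by auto
  qed (metis vCons_carrier_vec)
  also have "\<dots> \<longleftrightarrow> (\<exists>x. \<exists>c \<in> carrier_vec k. v = x \<cdot>\<^sub>v f + transpose_mat M *\<^sub>v c)"
    using transpose_add_row_mult_vec[OF assms] by auto
  finally show ?thesis .
qed

section \<open>The extended matrix and its completions\<close>

lemma extended_matrix_carrier [simp]: "extended_matrix k a G \<in> carrier_mat k (Suc (Suc (2 * k)))"
  by (simp add: extended_matrix_def)

lemma extended_matrix_dim [simp]:
  "dim_row (extended_matrix k a G) = k" "dim_col (extended_matrix k a G) = Suc (Suc (2 * k))"
  by (simp_all add: extended_matrix_def)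

text \<open>The two leading columns coincide, so the first two entries of a vector act only through
  their sum. Equal leading entries therefore cancel in characteristic 2.\<close>

lemma extended_matrix_mult_vec:
  assumes "G \<in> carrier_mat k (2 * k)" "w \<in> carrier_vec (2 * k)"
  shows "extended_matrix k a G *\<^sub>v vCons x (vCons y w) = (x + y) \<cdot>\<^sub>v vec k a + G *\<^sub>v w"
proof (rule eq_vecI)
  fix i assume "i < dim_vec ((x + y) \<cdot>\<^sub>v vec k a + G *\<^sub>v w)"
  then have i: "i < k" using assms by simp
  have "row (extended_matrix k a G) i = vCons (a i) (vCons (a i) (row G i))"
    using i assms by (intro eq_vecI) (auto simp: extended_matrix_def vec_index_vCons numeral_2_eq_2)
  then show "(extended_matrix k a G *\<^sub>v vCons x (vCons y w)) $ i = ((x + y) \<cdot>\<^sub>v vec k a + G *\<^sub>v w) $ i"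
    using i assms by (simp add: extended_matrix_def algebra_simps)
qed (use assms in \<open>simp add: extended_matrix_def\<close>)

lemma transpose_extended_matrix_mult_vec:
  assumes "G \<in> carrier_mat k (2 * k)" "c \<in> carrier_vec k"
  shows "transpose_mat (extended_matrix k a G) *\<^sub>v c =
    vCons (vec k a \<bullet> c) (vCons (vec k a \<bullet> c) (transpose_mat G *\<^sub>v c))"
proof (rule eq_vecI)
  fix i assume i: "i < dim_vec (vCons (vec k a \<bullet> c) (vCons (vec k a \<bullet> c) (transpose_mat G *\<^sub>v c)))"
  then have "col (extended_matrix k a G) i = (if i < 2 then vec k a else col G (i - 2))"
    using assms by (intro eq_vecI) (auto simp: extended_matrix_def)
  then show "(transpose_mat (extended_matrix k a G) *\<^sub>v c) $ i =
      vCons (vec k a \<bullet> c) (vCons (vec k a \<bullet> c) (transpose_mat G *\<^sub>v c)) $ i"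
    using i assms by (auto simp: extended_matrix_def vec_index_vCons numeral_2_eq_2)
qed (use assms in \<open>simp add: extended_matrix_def\<close>)

text \<open>The code in the definition can only be \<open>rowspan H\<close>, and independent rows
  give it rank \<open>k + 1\<close> by \<open>conv_code_rowspan\<close>.\<close>

lemma self_dual_completion_iff:
  assumes "E \<in> carrier_mat k (Suc (Suc (2 * k)))"
  shows "self_dual_completion k E H \<longleftrightarrow> (\<exists>f \<in> carrier_vec (Suc (Suc (2 * k))).
    H = add_row f E \<and> row_free H \<and> self_dual (Suc (Suc (2 * k))) (rowspan H))" (is "?l \<longleftrightarrow> ?r")
proof
  assume ?l
  then obtain f C where f: "f \<in> carrier_vec (Suc (Suc (2 * k)))" "H = add_row f E"
    and C: "self_dual (Suc (Suc (2 * k))) C" "generator_matrix (Suc (Suc (2 * k))) (Suc k) C H"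
    using assms unfolding self_dual_completion_def add_row_def by auto
  from f C generator_matrix_iff[OF add_row_carrier[OF assms]] show ?r by auto
next
  assume ?r
  then obtain f where f: "f \<in> carrier_vec (Suc (Suc (2 * k)))" "H = add_row f E"
    and H: "row_free H" "self_dual (Suc (Suc (2 * k))) (rowspan H)" by blast
  have HC: "H \<in> carrier_mat (Suc k) (Suc (Suc (2 * k)))" using assms f by simp
  have "conv_code (Suc (Suc (2 * k))) (Suc k) (rowspan H)" by (rule conv_code_rowspan[OF HC H(1)])
  moreover have "generator_matrix (Suc (Suc (2 * k))) (Suc k) (rowspan H) H"
    using generator_matrix_iff[OF HC] H by simp
  ultimately show ?l
    unfolding self_dual_completion_def using f H assms by (auto simp: add_row_def)
qed

lemma trivial_completion_iff:
  assumes "E \<in> carrier_mat k (Suc (Suc (2 * k)))"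
  shows "trivial_completion k E H \<longleftrightarrow> rowspan H = rowspan (add_row (vCons 1 (vCons 1 (0\<^sub>v (2 * k)))) E)"
proof -
  have "vec (Suc (Suc (2 * k))) (\<lambda>j. if j < 2 then 1 else 0) = vCons 1 (vCons 1 (0\<^sub>v (2 * k)) :: bit poly vec)"
    by (intro eq_vecI) (auto simp: vec_index_vCons)
  then show ?thesis using assms by (simp add: trivial_completion_def add_row_def)
qed

text \<open>Applied twice with \<open>f\<close> and \<open>g\<close> exchanged, this shows that two
  completions generate the same code.\<close>

lemma rowspan_add_row_mono:
  assumes M: "M \<in> carrier_mat k n" and f: "f \<in> carrier_vec n"
    and g: "g \<in> rowspan (add_row f M)"
  shows "rowspan (add_row g M) \<subseteq> rowspan (add_row f M)"
proof
  have gn: "g \<in> carrier_vec n" using g rowspan_carrier[OF add_row_carrier[OF M]] by blast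
  obtain x c where c: "c \<in> carrier_vec k" and g_eq: "g = x \<cdot>\<^sub>v f + transpose_mat M *\<^sub>v c"
    using g in_rowspan_add_row[OF M f] by blast
  fix v assume "v \<in> rowspan (add_row g M)"
  then obtain y d where d: "d \<in> carrier_vec k" and v: "v = y \<cdot>\<^sub>v g + transpose_mat M *\<^sub>v d"
    using in_rowspan_add_row[OF M gn] by blast
  have "v = (y * x) \<cdot>\<^sub>v f + transpose_mat M *\<^sub>v (y \<cdot>\<^sub>v c + d)"
    unfolding v g_eq using M f c d
    by (intro eq_vecI) (auto simp: scalar_prod_add_distrib[of _ k] algebra_simps)
  moreover have "y \<cdot>\<^sub>v c + d \<in> carrier_vec k" using c d by simp
  ultimately show "v \<in> rowspan (add_row f M)" using in_rowspan_add_row[OF M f] by blast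
qed

lemma self_dual_rowspan_iff:
  assumes "M \<in> carrier_mat k n"
  shows "self_dual n (rowspan M) \<longleftrightarrow>
    (\<forall>w \<in> carrier_vec n. w \<in> rowspan M \<longleftrightarrow> M *\<^sub>v w = 0\<^sub>v k)"
  using rowspan_carrier[OF assms] dual_code_rowspan[OF assms] unfolding self_dual_def by auto

section \<open>Orthogonality relations for the extension of a self-dual code\<close>

text \<open>The last assumption is self-duality of \<open>rowspan G\<close> in the form given by
  \<open>self_dual_rowspan_iff\<close>.\<close>

locale self_dual_generator =
  fixes k :: nat and G :: "bit poly mat" and a :: "nat \<Rightarrow> bit poly"
  assumes G: "G \<in> carrier_mat k (2 * k)" and free_G: "row_free G"
    and in_rowspan_G_iff:
      "\<And>w. w \<in> carrier_vec (2 * k) \<Longrightarrow> w \<in> rowspan G \<longleftrightarrow> G *\<^sub>v w = 0\<^sub>v k"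
begin

text \<open>\<open>e\<close> is the row added in the trivial completion. The length is written with
  two \<open>Suc\<close> to match the two leading \<open>vCons\<close> entries.\<close>

abbreviation "E \<equiv> extended_matrix k a G"
abbreviation "n \<equiv> Suc (Suc (2 * k))"
abbreviation "e \<equiv> vCons 1 (vCons 1 (0\<^sub>v (2 * k))) :: bit poly vec"

lemma E: "E \<in> carrier_mat k n" by simp

lemma e: "e \<in> carrier_vec n" by simp

lemma vec_n_cases:
  assumes "v \<in> carrier_vec n"
  obtains x y w where "v = vCons x (vCons y w)" "w \<in> carrier_vec (2 * k)"
proof (cases v)
  case (vCons x u)
  then show ?thesis using assms that by (cases u) auto
qed (use assms in auto)

lemma G_orthogonal: "c \<in> carrier_vec k \<Longrightarrow> G *\<^sub>v (transpose_mat G *\<^sub>v c) = 0\<^sub>v k"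
  using in_rowspan_G_iff[of "transpose_mat G *\<^sub>v c"] G by (auto simp: rowspan_eq[OF G])

text \<open>The two equal leading entries contribute the same term twice, which vanishes, and the
  remaining entries reduce to the self-orthogonality of \<open>G\<close>.\<close>

lemma E_orthogonal: "c \<in> carrier_vec k \<Longrightarrow> E *\<^sub>v (transpose_mat E *\<^sub>v c) = 0\<^sub>v k"
  using G G_orthogonal
  by (subst transpose_extended_matrix_mult_vec[OF G], simp, subst extended_matrix_mult_vec[OF G])
    (auto intro!: eq_vecI)

lemma E_e: "E *\<^sub>v e = 0\<^sub>v k"
  using G by (subst extended_matrix_mult_vec[OF G]) (auto intro!: eq_vecI)

lemma scalar_prod_transpose_E:
  assumes "c \<in> carrier_vec k" "v \<in> carrier_vec n" "E *\<^sub>v v = 0\<^sub>v k"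
  shows "v \<bullet> (transpose_mat E *\<^sub>v c) = 0"
  using transpose_mult_vec_scalar_prod[OF E assms(1,2)] assms by simp

text \<open>Orthogonality to \<open>e\<close> makes the two leading entries of \<open>v\<close>
  equal. They then cancel in \<open>E *\<^sub>v v\<close>, so the remaining entries form a word
  \<open>transpose_mat G *\<^sub>v c\<close> by self-duality. Subtracting
  \<open>transpose_mat E *\<^sub>v c\<close> leaves a multiple of \<open>e\<close>.\<close>

lemma orthogonal_decomposition:
  assumes "v \<in> carrier_vec n" "E *\<^sub>v v = 0\<^sub>v k" "e \<bullet> v = 0"
  obtains p c where "c \<in> carrier_vec k" "v = p \<cdot>\<^sub>v e + transpose_mat E *\<^sub>v c"
proof -
  obtain x y w where v: "v = vCons x (vCons y w)" and w: "w \<in> carrier_vec (2 * k)"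
    using assms(1) by (rule vec_n_cases)
  have xy: "x + y = 0" using assms(3) w unfolding v by simp
  then have "y = x" using bit_poly_eq_iff_add_eq_0 by auto
  have "G *\<^sub>v w = 0\<^sub>v k"
    using assms(2) G w unfolding v extended_matrix_mult_vec[OF G w] xy
    by (auto simp: vec_eq_iff)
  then obtain c where c: "c \<in> carrier_vec k" "w = transpose_mat G *\<^sub>v c"
    using in_rowspan_G_iff[OF w] by (auto simp: rowspan_eq[OF G])
  have "v = (x - vec k a \<bullet> c) \<cdot>\<^sub>v e + transpose_mat E *\<^sub>v c"
    unfolding transpose_extended_matrix_mult_vec[OF G c(1)] v \<open>y = x\<close> c(2)
    using G by (auto intro!: eq_vecI simp: vec_index_vCons)
  with c that show ?thesis by blast
qed

text \<open>Beyond the first two entries \<open>e\<close> vanishes and only \<open>G\<close> is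
  visible, so independence of its rows kills \<open>c\<close>; entry 0 then gives
  \<open>x\<close>.\<close>

lemma transpose_E_eq_0:
  assumes "c \<in> carrier_vec k" "x \<cdot>\<^sub>v e + transpose_mat E *\<^sub>v c = 0\<^sub>v n"
  shows "c = 0\<^sub>v k" "x = 0"
proof -
  have "(transpose_mat G *\<^sub>v c) $ i = 0" if "i < 2 * k" for i
    using arg_cong[OF assms(2), of "\<lambda>v. v $ Suc (Suc i)"] that G
    unfolding transpose_extended_matrix_mult_vec[OF G assms(1)] by simp
  then have "transpose_mat G *\<^sub>v c = 0\<^sub>v (2 * k)" using G by (intro eq_vecI) auto
  from row_freeD[OF free_G G assms(1) this] show c: "c = 0\<^sub>v k" .
  show "x = 0"
    using arg_cong[OF assms(2), of "\<lambda>v. v $ 0"]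
    unfolding transpose_extended_matrix_mult_vec[OF G assms(1)] unfolding c by simp
qed

text \<open>This independence lets \<open>row_free_kernel_separates\<close> produce a vector
  orthogonal to \<open>rowspan E\<close> but not to \<open>e\<close>.\<close>

lemma row_free_add_e: "row_free (add_row e E)"
  unfolding row_free_def
proof (intro ballI impI)
  fix d assume d: "d \<in> carrier_vec (dim_row (add_row e E))"
    "transpose_mat (add_row e E) *\<^sub>v d = 0\<^sub>v (dim_col (add_row e E))"
  then obtain x c where xc: "d = vCons x c" "c \<in> carrier_vec k" using E by (cases d) auto
  have "x \<cdot>\<^sub>v e + transpose_mat E *\<^sub>v c = 0\<^sub>v n"
    using d(2) E unfolding xc(1) transpose_add_row_mult_vec[OF E e xc(2)] by simp
  from transpose_E_eq_0[OF xc(2) this] show "d = 0\<^sub>v (dim_row (add_row e E))"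
    using E by (simp add: xc(1) zero_vec_Suc)
qed

lemma self_dual_add_row_iff:
  assumes "f \<in> carrier_vec n"
  shows "self_dual n (rowspan (add_row f E)) \<longleftrightarrow>
    (\<forall>v \<in> carrier_vec n. v \<in> rowspan (add_row f E) \<longleftrightarrow> f \<bullet> v = 0 \<and> E *\<^sub>v v = 0\<^sub>v k)"
  unfolding self_dual_rowspan_iff[OF add_row_carrier[OF E]] add_row_mult_vec[OF E assms]
  by (simp add: zero_vec_Suc)

section \<open>From a non-trivial completion to the all-one vector\<close>

lemma nontrivial_imp_ones_in_rowspan:
  assumes "self_dual_completion k E H" "\<not> trivial_completion k E H"
  shows "vec n (\<lambda>_. 1) \<in> rowspan E"
proof -
  let ?one = "\<lambda>m. vec m (\<lambda>_. 1) :: bit poly vec"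
  obtain f where f: "f \<in> carrier_vec n" and H: "H = add_row f E"
    and sd: "self_dual n (rowspan (add_row f E))"
    using assms(1) unfolding self_dual_completion_iff[OF E] by (elim bexE conjE) simp
  note mem = bspec[OF sd[unfolded self_dual_add_row_iff[OF f]]]
  have "?one n \<in> rowspan (add_row f E)"
    using rowspan_subset_dual_imp_ones[OF add_row_carrier[OF E]] sd unfolding self_dual_def by auto
  then obtain x c where c: "c \<in> carrier_vec k" and one: "?one n = x \<cdot>\<^sub>v f + transpose_mat E *\<^sub>v c"
    using in_rowspan_add_row[OF E f] by blast
  \<comment> \<open>If \<open>x \<noteq> 0\<close>, the last \<open>2 k\<close> entries of \<open>f\<close> lie in the code of \<open>G\<close>, as dual codes are saturated.\<close>
  have "x = 0"
  proof (rule ccontr)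
    assume x: "x \<noteq> 0"
    obtain p q w where f_eq: "f = vCons p (vCons q w)" and w: "w \<in> carrier_vec (2 * k)"
      using f by (rule vec_n_cases)
    have "rowspan G \<subseteq> dual_code (2 * k) (rowspan G)"
      using rowspan_carrier[OF G] in_rowspan_G_iff unfolding dual_code_rowspan[OF G] by auto
    from rowspan_subset_dual_imp_ones[OF G this]
    have G_one: "G *\<^sub>v ?one (2 * k) = 0\<^sub>v k" unfolding dual_code_rowspan[OF G] by blast
    have one': "?one (2 * k) = x \<cdot>\<^sub>v w + transpose_mat G *\<^sub>v c"
    proof (rule eq_vecI)
      fix i assume "i < dim_vec (x \<cdot>\<^sub>v w + transpose_mat G *\<^sub>v c)"
      then show "?one (2 * k) $ i = (x \<cdot>\<^sub>v w + transpose_mat G *\<^sub>v c) $ i"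
        using arg_cong[OF one, of "\<lambda>v. v $ Suc (Suc i)"] G w
        unfolding transpose_extended_matrix_mult_vec[OF G c] f_eq by simp
    qed (use G in simp)
    \<comment> \<open>Multiply \<open>one'\<close> by \<open>G\<close>: both the all-one vector and
      \<open>transpose_mat G *\<^sub>v c\<close> are annihilated, and the factor \<open>x\<close>
      can then be cancelled.\<close>
    have "x \<cdot>\<^sub>v (G *\<^sub>v w) = 0\<^sub>v k"
      using G_one mult_add_distrib_mat_vec[OF G, of "x \<cdot>\<^sub>v w" "transpose_mat G *\<^sub>v c"] w G c
      unfolding one' by (simp add: G_orthogonal mult_mat_vec_smult[OF G w])
    then have Gw: "G *\<^sub>v w = 0\<^sub>v k" using x by (auto simp: vec_eq_iff)
    then obtain b where b: "b \<in> carrier_vec k" "w = transpose_mat G *\<^sub>v b"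
      using in_rowspan_G_iff[OF w] by (auto simp: rowspan_eq[OF G])
    have ww: "w \<bullet> w = 0"
      using transpose_mult_vec_scalar_prod[OF G b(1) w] Gw b by simp
    have "f \<in> rowspan (add_row f E)"
      unfolding in_rowspan_add_row[OF E f]
      using f E by (intro exI[of _ 1] bexI[of _ "0\<^sub>v k"]) (auto intro!: eq_vecI)
    then have ff: "f \<bullet> f = 0" and Ef: "E *\<^sub>v f = 0\<^sub>v k" using mem[OF f] by auto
    \<comment> \<open>As \<open>w \<bullet> w = 0\<close>, the product
      \<open>f \<bullet> f = 0\<close> equals the square of \<open>p + q\<close>, which is
      \<open>e \<bullet> f\<close>.\<close>
    have "(p + q) * (p + q) = p * p + q * q + (p * q + p * q)" by (simp only: algebra_simps)
    also have "\<dots> = f \<bullet> f" using ww by (simp add: f_eq del: mult_2)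
    finally have "p + q = 0" using ff by simp
    then have ef: "e \<bullet> f = 0" using w by (simp add: f_eq)
    then have fe: "f \<bullet> e = 0" using comm_scalar_prod[OF e f] by simp
    \<comment> \<open>So \<open>f\<close> lies in the trivial code. Conversely \<open>e\<close>,
      being orthogonal to \<open>f\<close> and to the rows of \<open>E\<close>, lies in the
      self-dual code of \<open>H\<close>; the two codes coincide.\<close>
    obtain r d where "d \<in> carrier_vec k" "f = r \<cdot>\<^sub>v e + transpose_mat E *\<^sub>v d"
      using orthogonal_decomposition[OF f Ef ef] .
    then have "f \<in> rowspan (add_row e E)" using in_rowspan_add_row[OF E e] by blast
    moreover have "e \<in> rowspan (add_row f E)" using mem[OF e] fe E_e by simp
    ultimately have "rowspan H = rowspan (add_row e E)"
      using rowspan_add_row_mono[OF E] e f unfolding H by blast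
    then show False using assms(2) trivial_completion_iff[OF E] by simp
  qed
  then have "?one n = transpose_mat E *\<^sub>v c" using f c one E by (auto intro!: eq_vecI)
  then show ?thesis using c by (auto simp: rowspan_eq[OF E])
qed

section \<open>From the all-one vector to a non-trivial completion\<close>

lemma ones_in_rowspan_imp_nontrivial:
  assumes "vec n (\<lambda>_. 1) \<in> rowspan E"
  shows "\<exists>H. self_dual_completion k E H \<and> \<not> trivial_completion k E H"
proof -
  obtain c0 where c0: "c0 \<in> carrier_vec k" "vec n (\<lambda>_. 1) = transpose_mat E *\<^sub>v c0"
    using assms by (auto simp: rowspan_eq[OF E])
  define P where "P v \<longleftrightarrow> v \<in> carrier_vec n \<and> E *\<^sub>v v = 0\<^sub>v k \<and> e \<bullet> v \<noteq> 0" for v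
  have "\<exists>v. P v"
    using row_free_kernel_separates[OF E row_free_add_rowD[OF row_free_add_e E e] e row_free_add_e]
    unfolding P_def by blast
  then obtain v0 where "P v0" ..
  then obtain t where t: "P t" and t_min: "\<And>v. P v \<Longrightarrow> degree (e \<bullet> t) \<le> degree (e \<bullet> v)"
    using ex_has_least_nat[of P v0 "\<lambda>v. degree (e \<bullet> v)"] by blast
  from t have tn: "t \<in> carrier_vec n" and Et: "E *\<^sub>v t = 0\<^sub>v k" and et: "e \<bullet> t \<noteq> 0"
    by (auto simp: P_def)
  have te: "t \<bullet> e \<noteq> 0" using et comm_scalar_prod[OF e tn] by simp
  \<comment> \<open>Here the hypothesis enters: \<open>t\<close> is orthogonal to
    \<open>rowspan E\<close>, hence to the all-one vector.\<close>
  have tt: "t \<bullet> t = 0"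
    using scalar_prod_self[OF tn] scalar_prod_transpose_E[OF c0(1) tn Et] c0(2) by simp
  \<comment> \<open>Since \<open>e\<close> is orthogonal to \<open>rowspan E\<close>, pairing with
    \<open>e\<close> reads off the coefficient of \<open>t\<close>.\<close>
  have e_comb: "e \<bullet> (x \<cdot>\<^sub>v t + transpose_mat E *\<^sub>v c) = x * (e \<bullet> t)"
    if "c \<in> carrier_vec k" for x c
    using scalar_prod_add_distrib[OF e, of "x \<cdot>\<^sub>v t" "transpose_mat E *\<^sub>v c"]
      scalar_prod_smult_distrib[OF e tn] scalar_prod_transpose_E[OF that e E_e] tn E that by simp
  have "row_free (add_row t E)"
    unfolding row_free_def
  proof (intro ballI impI)
    fix d assume d: "d \<in> carrier_vec (dim_row (add_row t E))"
      "transpose_mat (add_row t E) *\<^sub>v d = 0\<^sub>v (dim_col (add_row t E))"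
    then obtain x c where xc: "d = vCons x c" "c \<in> carrier_vec k" using E by (cases d) auto
    have 0: "x \<cdot>\<^sub>v t + transpose_mat E *\<^sub>v c = 0\<^sub>v n"
      using d(2) E unfolding xc(1) transpose_add_row_mult_vec[OF E tn xc(2)] by simp
    have "x * (e \<bullet> t) = 0" using e_comb[OF xc(2), of x] scalar_prod_right_zero[OF e] unfolding 0 by simp
    then have x: "x = 0" using et by simp
    have "0 \<cdot>\<^sub>v e + transpose_mat E *\<^sub>v c = 0\<^sub>v n"
      using 0 tn E unfolding x by (auto simp: vec_eq_iff)
    from transpose_E_eq_0(1)[OF xc(2) this] x show "d = 0\<^sub>v (dim_row (add_row t E))"
      using E by (simp add: xc(1) zero_vec_Suc)
  qed
  moreover have "self_dual n (rowspan (add_row t E))"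
    unfolding self_dual_add_row_iff[OF tn]
  proof (intro ballI iffI)
    fix v :: "bit poly vec" assume v: "v \<in> carrier_vec n"
    {
      assume "v \<in> rowspan (add_row t E)"
      then obtain x c where c: "c \<in> carrier_vec k" and v_eq: "v = x \<cdot>\<^sub>v t + transpose_mat E *\<^sub>v c"
        using in_rowspan_add_row[OF E tn] by blast
      have cE: "transpose_mat E *\<^sub>v c \<in> carrier_vec n"
      using c by (intro mult_mat_vec_carrier[of _ _ k]) simp_all
      have "t \<bullet> v = 0"
        unfolding v_eq using scalar_prod_add_distrib[OF tn _ cE, of "x \<cdot>\<^sub>v t"]
          scalar_prod_smult_distrib[OF tn tn] scalar_prod_transpose_E[OF c tn Et] tt tn by simp
      moreover have "E *\<^sub>v v = 0\<^sub>v k"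
        unfolding v_eq using mult_add_distrib_mat_vec[OF E _ cE, of "x \<cdot>\<^sub>v t"] tn
          mult_mat_vec_smult[OF E tn] E_orthogonal[OF c] Et by (auto intro!: eq_vecI)
      ultimately show "t \<bullet> v = 0 \<and> E *\<^sub>v v = 0\<^sub>v k" ..
    }
    assume tv: "t \<bullet> v = 0 \<and> E *\<^sub>v v = 0\<^sub>v k"
    \<comment> \<open>Subtracting this multiple of \<open>t\<close> turns
      \<open>e \<bullet> v\<close> into its remainder modulo \<open>e \<bullet> t\<close>, and the
      difference stays orthogonal to \<open>rowspan E\<close>.\<close>
    define q where "q = (e \<bullet> v) div (e \<bullet> t)"
    define r where "r = v - q \<cdot>\<^sub>v t"
    have r: "r \<in> carrier_vec n" using v tn by (simp add: r_def)
    have v_eq: "v = q \<cdot>\<^sub>v t + r" using v tn by (auto intro!: eq_vecI simp: r_def)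
    have Er: "E *\<^sub>v r = 0\<^sub>v k"
      unfolding r_def using mult_minus_distrib_mat_vec[OF E v, of "q \<cdot>\<^sub>v t"] tn tv
        mult_mat_vec_smult[OF E tn] Et by (auto intro!: eq_vecI)
    have "e \<bullet> r = e \<bullet> v - q * (e \<bullet> t)"
      unfolding r_def using scalar_prod_minus_distrib[OF e v, of "q \<cdot>\<^sub>v t"]
        scalar_prod_smult_distrib[OF e tn] tn by simp
    then have er_mod: "e \<bullet> r = (e \<bullet> v) mod (e \<bullet> t)"
      unfolding q_def by (simp only: minus_div_mult_eq_mod)
    \<comment> \<open>A non-zero remainder would make \<open>r\<close> a candidate of smaller degree
      than \<open>t\<close>.\<close>
    have er: "e \<bullet> r = 0"
    proof (rule ccontr)
      assume "e \<bullet> r \<noteq> 0"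
      then have "degree (e \<bullet> r) < degree (e \<bullet> t)" "P r"
        using degree_mod_less[OF et, of "e \<bullet> v"] r Er unfolding P_def er_mod by auto
      with t_min[of r] show False by simp
    qed
    obtain p c where c: "c \<in> carrier_vec k" and r_eq: "r = p \<cdot>\<^sub>v e + transpose_mat E *\<^sub>v c"
      using orthogonal_decomposition[OF r Er er] .
    have cE: "transpose_mat E *\<^sub>v c \<in> carrier_vec n"
      using c by (intro mult_mat_vec_carrier[of _ _ k]) simp_all
    \<comment> \<open>Pairing with \<open>t\<close> isolates the coefficient of \<open>e\<close>.
      The value is also \<open>t \<bullet> v = 0\<close>, because \<open>t \<bullet> t = 0\<close>,
      so \<open>p\<close> must vanish.\<close>
    have "t \<bullet> r = p * (t \<bullet> e)"
      unfolding r_eq using scalar_prod_add_distrib[OF tn _ cE, of "p \<cdot>\<^sub>v e"]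
        scalar_prod_smult_distrib[OF tn e] scalar_prod_transpose_E[OF c tn Et] e
      by (simp del: scalar_prod_vCons)
    moreover have "t \<bullet> r = t \<bullet> v"
      using scalar_prod_add_distrib[OF tn _ r, of "q \<cdot>\<^sub>v t"]
        scalar_prod_smult_distrib[OF tn tn] tt tn unfolding v_eq by simp
    ultimately have "p = 0" using tv te by simp
    then have "v = q \<cdot>\<^sub>v t + transpose_mat E *\<^sub>v c"
      using v_eq r_eq tn cE by (auto intro!: eq_vecI)
    then show "v \<in> rowspan (add_row t E)" using in_rowspan_add_row[OF E tn] c by blast
  qed
  ultimately have "self_dual_completion k E (add_row t E)"
    using self_dual_completion_iff[OF E] tn by blast
  moreover have "\<not> trivial_completion k E (add_row t E)"
  proof
    assume "trivial_completion k E (add_row t E)"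
    moreover have "e \<in> rowspan (add_row e E)"
      unfolding in_rowspan_add_row[OF E e]
      using e E by (intro exI[of _ 1] bexI[of _ "0\<^sub>v k"]) (auto intro!: eq_vecI)
    ultimately have "e \<in> rowspan (add_row t E)" using trivial_completion_iff[OF E] by simp
    \<comment> \<open>In a self-dual code containing \<open>t\<close>, the word \<open>e\<close>
      would be orthogonal to \<open>t\<close>, against the choice of \<open>t\<close>.\<close>
    then have "t \<bullet> e = 0"
      using \<open>self_dual n (rowspan (add_row t E))\<close> self_dual_add_row_iff[OF tn] e by blast
    with te show False ..
  qed
  ultimately show ?thesis by blast
qed

end

theorem theorem8:
  fixes k :: nat and C :: "bit poly vec set" and G :: "bit poly mat" and a :: "nat \<Rightarrow> bit poly"
  assumes "conv_code (2 * k) k C"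
    and "self_dual (2 * k) C"
    and "generator_matrix (2 * k) k C G"
  shows "(\<exists>G1. self_dual_completion k (extended_matrix k a G) G1 \<and>
               \<not> trivial_completion k (extended_matrix k a G) G1) \<longleftrightarrow>
         vec (2 * k + 2) (\<lambda>_. 1) \<in> rowspan (extended_matrix k a G)"
proof -
  have G: "G \<in> carrier_mat k (2 * k)" using assms(3) by (simp add: generator_matrix_def)
  have free: "row_free G" and C: "C = rowspan G"
    using assms(3) by (auto simp: generator_matrix_iff[OF G])
  interpret self_dual_generator k G a
    using G free assms(2) unfolding C self_dual_rowspan_iff[OF G] by unfold_locales auto
  show ?thesis
    using nontrivial_imp_ones_in_rowspan ones_in_rowspan_imp_nontrivial by auto
qed

end
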